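(* Let $A$ and $X$ be linear orders. Then $A^2X\cong X$ if and only if $X$ is isomorphic to an order of the form $A^{\omega}(I_{[u]_2})$, i.e. to a replacement $A^{\omega}(I_u)$ where $(I_u)_{u\in A^\omega}$ is a family of linear orders (possibly empty) such that $I_u=I_v$ whenever $u\sim_2 v$.
   Context: Products are lexicographic; $A^2X=A\times A\times X$. $A^\omega$ is the set of infinite sequences of elements of $A$ ordered lexicographically. $u\sim_2 v$ in $A^\omega$ iff there exist finite sequences $r,s$ with $|r|\equiv|s|\pmod 2$ and $u'\in A^\omega$ with $u=ru'$ and $v=su'$ (concatenation). Replacement: for a linear order $Y$ and orders $I_y$ ($y\in Y$, possibly empty), $Y(I_y)$ is the set $\{(y,i):y\in Y,i\in I_y\}$ ordered lexicographically. *)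

theory Defs
  imports Main "HOL-Library.Stream"
begin

text \<open>
  A linear order is a reflexive relation \<open>r\<close> with \<open>Linear_order r\<close>; its underlying set is
  \<open>Field r\<close>, so the empty order is the empty relation. Isomorphism is the library's \<^const>\<open>iso\<close>,
  which by \<open>iso_iff2\<close> means, for arbitrary relations, a bijection between the fields that
  preserves and reflects the relation.
\<close>

definition order_isomorphic :: "'a rel \<Rightarrow> 'b rel \<Rightarrow> bool" (infix \<open>\<cong>\<^sub>o\<close> 50) where
  "r \<cong>\<^sub>o s \<longleftrightarrow> (\<exists>f. iso r s f)"

text \<open>
  The library's \<open><*lex*>\<close> expects a strict relation on the left and does not constrain the second
  components when the first ones differ; hence the removal of the diagonal and the restriction.
\<close>

definition lex_product :: "'a rel \<Rightarrow> 'b rel \<Rightarrow> ('a \<times> 'b) rel" (infixr \<open>\<times>\<^sub>l\<close> 80) where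
  "r \<times>\<^sub>l s = Restr ((r - Id) <*lex*> s) (Field r \<times> Field s)"

definition omega_power :: "'a rel \<Rightarrow> 'a stream rel" where
  "omega_power A = {(u, v). u \<in> streams (Field A) \<and> v \<in> streams (Field A) \<and>
     (u = v \<or> (\<exists>n. (\<forall>i<n. u !! i = v !! i) \<and> u !! n \<noteq> v !! n \<and> (u !! n, v !! n) \<in> A))}"

definition tail_equiv2 :: "'a rel \<Rightarrow> 'a stream \<Rightarrow> 'a stream \<Rightarrow> bool" where
  "tail_equiv2 A u v \<longleftrightarrow>
     (\<exists>r \<in> lists (Field A). \<exists>s \<in> lists (Field A). \<exists>u' \<in> streams (Field A).
        length r mod 2 = length s mod 2 \<and> u = r @- u' \<and> v = s @- u')"

definition replacement :: "'y rel \<Rightarrow> ('y \<Rightarrow> 'i rel) \<Rightarrow> ('y \<times> 'i) rel" where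
  "replacement Y I = {((y, i), (y', i')).
     y \<in> Field Y \<and> i \<in> Field (I y) \<and> y' \<in> Field Y \<and> i' \<in> Field (I y') \<and>
     (y \<noteq> y' \<and> (y, y') \<in> Y \<or> y = y' \<and> (i, i') \<in> I y)}"

definition invariant_family2 :: "'a rel \<Rightarrow> ('a stream \<Rightarrow> 'i rel) \<Rightarrow> bool" where
  "invariant_family2 A I \<longleftrightarrow>
     (\<forall>u \<in> streams (Field A). Linear_order (I u)) \<and>
     (\<forall>u \<in> streams (Field A). \<forall>v \<in> streams (Field A). tail_equiv2 A u v \<longrightarrow> I u = I v)"

lemma Linear_orderI:
  assumes "\<And>x. x \<in> Field r \<Longrightarrow> (x, x) \<in> r"
    and "\<And>x y z. (x, y) \<in> r \<Longrightarrow> (y, z) \<in> r \<Longrightarrow> (x, z) \<in> r"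
    and "\<And>x y. (x, y) \<in> r \<Longrightarrow> (y, x) \<in> r \<Longrightarrow> x = y"
    and "\<And>x y. x \<in> Field r \<Longrightarrow> y \<in> Field r \<Longrightarrow> x \<noteq> y \<Longrightarrow> (x, y) \<in> r \<or> (y, x) \<in> r"
  shows "Linear_order r"
  unfolding order_on_defs
proof (intro conjI)
  show "r \<subseteq> Field r \<times> Field r" by (auto simp: Field_def)
  show "refl_on (Field r) r" using assms(1) by (auto simp: refl_on_def)
  show "trans r" using assms(2) by (blast intro: transI)
  show "antisym r" using assms(3) by (blast intro: antisymI)
  show "total_on (Field r) r" using assms(4) by (auto simp: total_on_def)
qed

lemma Linear_orderD:
  assumes "Linear_order r"
  shows "x \<in> Field r \<Longrightarrow> (x, x) \<in> r"
    and "(x, y) \<in> r \<Longrightarrow> (y, z) \<in> r \<Longrightarrow> (x, z) \<in> r"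
    and "(x, y) \<in> r \<Longrightarrow> (y, x) \<in> r \<Longrightarrow> x = y"
    and "x \<in> Field r \<Longrightarrow> y \<in> Field r \<Longrightarrow> (x, y) \<in> r \<or> (y, x) \<in> r"
proof -
  have r: "refl_on (Field r) r" "trans r" "antisym r" "total_on (Field r) r"
    using assms by (simp_all add: order_on_defs)
  show refl: "x \<in> Field r \<Longrightarrow> (x, x) \<in> r" for x using r(1) by (rule refl_onD)
  show "(x, y) \<in> r \<Longrightarrow> (y, z) \<in> r \<Longrightarrow> (x, z) \<in> r" using r(2) by (rule transD)
  show "(x, y) \<in> r \<Longrightarrow> (y, x) \<in> r \<Longrightarrow> x = y" using r(3) by (rule antisymD)
  show "x \<in> Field r \<Longrightarrow> y \<in> Field r \<Longrightarrow> (x, y) \<in> r \<or> (y, x) \<in> r"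
    using r(4) refl by (cases "x = y") (auto simp: total_on_def)
qed

lemma lex_product_eq_replacement: "r \<times>\<^sub>l s = replacement r (\<lambda>_. s)"
  by (auto simp: lex_product_def replacement_def)

lemma Field_replacement:
  assumes "\<And>y. y \<in> Field Y \<Longrightarrow> Linear_order (I y)"
  shows "Field (replacement Y I) = (SIGMA y : Field Y. Field (I y))"
proof
  show "Field (replacement Y I) \<subseteq> (SIGMA y : Field Y. Field (I y))"
    by (auto simp: replacement_def Field_def)
  show "(SIGMA y : Field Y. Field (I y)) \<subseteq> Field (replacement Y I)"
  proof clarify
    fix y i assume "y \<in> Field Y" "i \<in> Field (I y)"
    then have "((y, i), (y, i)) \<in> replacement Y I"
      using Linear_orderD(1)[OF assms] by (auto simp: replacement_def)
    then show "(y, i) \<in> Field (replacement Y I)" by (rule FieldI1)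
  qed
qed

lemma Linear_order_replacement:
  assumes Y: "Linear_order Y" and I: "\<And>y. y \<in> Field Y \<Longrightarrow> Linear_order (I y)"
  shows "Linear_order (replacement Y I)"
proof -
  have Field_eq: "Field (replacement Y I) = (SIGMA y : Field Y. Field (I y))"
    using I by (rule Field_replacement)
  show ?thesis
  proof (rule Linear_orderI)
    fix x y z assume xy: "(x, y) \<in> replacement Y I" and yz: "(y, z) \<in> replacement Y I"
    obtain a i b j c k where eq: "x = (a, i)" "y = (b, j)" "z = (c, k)"
      by (metis surj_pair)
    consider "a = b" "b = c" | "a \<noteq> b \<or> b \<noteq> c" by blast
    then show "(x, z) \<in> replacement Y I"
    proof cases
      case 1 then show ?thesis
        using xy yz Linear_orderD(2)[OF I] by (auto simp: eq replacement_def)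
    next
      case 2
      have "(a, c) \<in> Y"
        using xy yz 2 Linear_orderD(2)[OF Y, of a b c] by (auto simp: eq replacement_def)
      moreover have "a \<noteq> c"
        using xy yz 2 Linear_orderD(3)[OF Y, of a b] by (auto simp: eq replacement_def)
      ultimately show ?thesis using xy yz by (auto simp: eq replacement_def)
    qed
  next
    fix x y assume xy: "(x, y) \<in> replacement Y I" and yx: "(y, x) \<in> replacement Y I"
    obtain a i b j where eq: "x = (a, i)" "y = (b, j)"
      by (metis surj_pair)
    have "a = b" using xy yx Linear_orderD(3)[OF Y, of a b] by (auto simp: eq replacement_def)
    then show "x = y"
      using xy yx Linear_orderD(3)[OF I, of a i j] by (auto simp: eq replacement_def)
  next
    fix x assume "x \<in> Field (replacement Y I)"
    then show "(x, x) \<in> replacement Y I"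
      unfolding Field_eq
      using Linear_orderD(1)[OF I] by (auto simp: replacement_def)
  next
    fix x y assume xy: "x \<in> Field (replacement Y I)" "y \<in> Field (replacement Y I)"
    obtain a i b j where eq: "x = (a, i)" "y = (b, j)"
      by (metis surj_pair)
    show "(x, y) \<in> replacement Y I \<or> (y, x) \<in> replacement Y I"
      using xy Linear_orderD(4)[OF Y, of a b] Linear_orderD(4)[OF I, of a i j]
      unfolding Field_eq
      by (auto simp: eq replacement_def)
  qed
qed

lemma Field_omega_power: "Field (omega_power A) = streams (Field A)"
  by (auto simp: Field_def omega_power_def)

lemma Linear_order_omega_power:
  assumes A: "Linear_order A"
  shows "Linear_order (omega_power A)"
proof (rule Linear_orderI)
  fix u assume "u \<in> Field (omega_power A)"
  then show "(u, u) \<in> omega_power A" by (simp add: Field_omega_power) (simp add: omega_power_def)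
next
  fix u v w assume uv: "(u, v) \<in> omega_power A" and vw: "(v, w) \<in> omega_power A"
  show "(u, w) \<in> omega_power A"
  proof (cases "u = v \<or> v = w")
    case True then show ?thesis using uv vw by auto
  next
    case False
    then obtain n m where n: "\<forall>i<n. u !! i = v !! i" "u !! n \<noteq> v !! n" "(u !! n, v !! n) \<in> A"
      and m: "\<forall>i<m. v !! i = w !! i" "v !! m \<noteq> w !! m" "(v !! m, w !! m) \<in> A"
      using uv vw by (auto simp: omega_power_def)
    have "\<forall>i<min n m. u !! i = w !! i" using n m by simp
    moreover have "u !! min n m \<noteq> w !! min n m \<and> (u !! min n m, w !! min n m) \<in> A"
    proof -
      consider "n < m" | "n = m" | "m < n" by linarith
      then show ?thesis
      proof cases
        case 1 then show ?thesis using n m by (metis min.absorb3)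
      next
        case 2 then show ?thesis using n m Linear_orderD(2,3)[OF A] by (metis min.idem)
      next
        case 3 then show ?thesis using n m by (metis min.absorb4)
      qed
    qed
    ultimately show ?thesis using uv vw unfolding omega_power_def by blast
  qed
next
  fix u v assume uv: "(u, v) \<in> omega_power A" and vu: "(v, u) \<in> omega_power A"
  show "u = v"
  proof (rule ccontr)
    assume "u \<noteq> v"
    then obtain n m where n: "\<forall>i<n. u !! i = v !! i" "u !! n \<noteq> v !! n" "(u !! n, v !! n) \<in> A"
      and m: "\<forall>i<m. v !! i = u !! i" "v !! m \<noteq> u !! m" "(v !! m, u !! m) \<in> A"
      using uv vu by (auto simp: omega_power_def)
    have "n = m" using n m by (metis nat_neq_iff)
    then show False using n m Linear_orderD(3)[OF A] by blast
  qed
next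
  fix u v assume "u \<in> Field (omega_power A)" "v \<in> Field (omega_power A)" and "u \<noteq> v"
  then have u: "u \<in> streams (Field A)" and v: "v \<in> streams (Field A)"
    by (simp_all add: Field_omega_power)
  have "\<not> (\<forall>n. u !! n = v !! n)"
  proof
    assume "\<forall>n. u !! n = v !! n"
    then have "snth u = snth v" by (intro ext) simp
    then show False using \<open>u \<noteq> v\<close> stream_smap_nats[of u] stream_smap_nats[of v] by simp
  qed
  then have ex: "\<exists>n. u !! n \<noteq> v !! n" by blast
  define n where "n = (LEAST n. u !! n \<noteq> v !! n)"
  have n: "u !! n \<noteq> v !! n" "\<forall>i<n. u !! i = v !! i"
    unfolding n_def using LeastI_ex[OF ex] not_less_Least by blast+
  have "u !! n \<in> Field A" "v !! n \<in> Field A"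
    using u v by (simp_all add: streams_iff_snth)
  then have "(u !! n, v !! n) \<in> A \<or> (v !! n, u !! n) \<in> A" by (rule Linear_orderD(4)[OF A])
  then show "(u, v) \<in> omega_power A \<or> (v, u) \<in> omega_power A"
  proof
    assume "(u !! n, v !! n) \<in> A"
    then have "(u, v) \<in> omega_power A"
      using u v n unfolding omega_power_def by blast
    then show ?thesis ..
  next
    assume "(v !! n, u !! n) \<in> A"
    moreover have "v !! n \<noteq> u !! n" "\<forall>i<n. v !! i = u !! i" using n by auto
    ultimately have "(v, u) \<in> omega_power A"
      using u v unfolding omega_power_def by blast
    then show ?thesis ..
  qed
qed

end

theory Submission
  imports Defs
begin

text \<open>
  An isomorphism \<open>g : X \<rightarrow> A\<^sup>2X\<close> assigns to each point \<open>x\<close> the infinite sequence of pairs of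
  \<open>A\<close>-coordinates met when \<open>g\<close> is iterated on the \<open>X\<close>-coordinate. This coding is monotone into
  \<open>A\<^sup>\<omega>\<close>, so \<open>X\<close> is the replacement of \<open>A\<^sup>\<omega>\<close> by its fibres, and deleting the first two letters
  of the code is an isomorphism between fibres. Hence fibres over \<open>\<sim>\<^sub>2\<close>-equivalent sequences are
  isomorphic, and choosing one order per isomorphism type makes them equal. Conversely,
  prepending two letters does not leave the \<open>\<sim>\<^sub>2\<close>-class, so it maps \<open>A\<^sup>2A\<^sup>\<omega>(I\<^sub>u)\<close> onto \<open>A\<^sup>\<omega>(I\<^sub>u)\<close>.
\<close>

section \<open>Isomorphism and restriction of linear orders\<close>

lemma order_isomorphic_refl: "r \<cong>\<^sub>o r"
  unfolding order_isomorphic_def iso_iff2 by (intro exI[of _ id]) auto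

lemma order_isomorphic_sym:
  assumes "r \<cong>\<^sub>o s"
  shows "s \<cong>\<^sub>o r"
proof -
  obtain f where f: "bij_betw f (Field r) (Field s)"
    "\<And>a b. a \<in> Field r \<Longrightarrow> b \<in> Field r \<Longrightarrow> (a, b) \<in> r \<longleftrightarrow> (f a, f b) \<in> s"
    using assms unfolding order_isomorphic_def iso_iff2 by blast
  let ?g = "inv_into (Field r) f"
  have g: "bij_betw ?g (Field s) (Field r)" using f(1) by (rule bij_betw_inv_into)
  have "(a, b) \<in> s \<longleftrightarrow> (?g a, ?g b) \<in> r" if "a \<in> Field s" "b \<in> Field s" for a b
    using that f(2)[of "?g a" "?g b"] bij_betw_inv_into_right[OF f(1)] bij_betwE[OF g] by auto
  then have "iso s r ?g" using g unfolding iso_iff2 by blast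
  then show ?thesis unfolding order_isomorphic_def by blast
qed

lemma order_isomorphic_trans [trans]:
  assumes "r \<cong>\<^sub>o s" "s \<cong>\<^sub>o t"
  shows "r \<cong>\<^sub>o t"
proof -
  obtain f where f: "bij_betw f (Field r) (Field s)"
    "\<forall>a\<in>Field r. \<forall>b\<in>Field r. (a, b) \<in> r \<longleftrightarrow> (f a, f b) \<in> s"
    using assms(1) unfolding order_isomorphic_def iso_iff2 by blast
  obtain g where g: "bij_betw g (Field s) (Field t)"
    "\<forall>a\<in>Field s. \<forall>b\<in>Field s. (a, b) \<in> s \<longleftrightarrow> (g a, g b) \<in> t"
    using assms(2) unfolding order_isomorphic_def iso_iff2 by blast
  have "iso r t (g \<circ> f)"
    unfolding iso_iff2 using bij_betw_trans[OF f(1) g(1)] f(2) g(2) bij_betwE[OF f(1)] by simp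
  then show ?thesis unfolding order_isomorphic_def by blast
qed

text \<open>Between linear orders monotonicity already implies reflection. If reflection failed at
  \<open>a\<close>, \<open>b\<close>, totality of \<open>r\<close> would give \<open>(b, a)\<close>
  in \<open>r\<close>; antisymmetry of \<open>s\<close> then yields \<open>f a = f b\<close>, and
  injectivity \<open>a = b\<close>.\<close>

lemma order_isomorphicI:
  assumes r: "Linear_order r" and s: "Linear_order s"
    and f: "bij_betw f (Field r) (Field s)"
    and mono: "\<And>a b. (a, b) \<in> r \<Longrightarrow> (f a, f b) \<in> s"
  shows "r \<cong>\<^sub>o s"
proof -
  have "(a, b) \<in> r" if "a \<in> Field r" "b \<in> Field r" "(f a, f b) \<in> s" for a b
  proof (rule ccontr)
    assume "(a, b) \<notin> r"
    then have "(b, a) \<in> r" using Linear_orderD(4)[OF r] that by blast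
    then have "f a = f b" using Linear_orderD(3)[OF s] mono that(3) by blast
    then have "a = b" using f that by (meson bij_betw_imp_inj_on inj_onD)
    then show False using \<open>(a, b) \<notin> r\<close> \<open>(b, a) \<in> r\<close> by simp
  qed
  then have "iso r s f" unfolding iso_iff2 using f mono by blast
  then show ?thesis unfolding order_isomorphic_def by blast
qed

text \<open>The representatives chosen in \<open>fibre_rep\<close> are known only up to isomorphism;
  this transfers linearity to them.\<close>

lemma Linear_order_isomorphic:
  assumes r: "Linear_order r" and iso: "s \<cong>\<^sub>o r"
  shows "Linear_order s"
proof -
  obtain f where f: "bij_betw f (Field s) (Field r)"
    "\<And>a b. a \<in> Field s \<Longrightarrow> b \<in> Field s \<Longrightarrow> (a, b) \<in> s \<longleftrightarrow> (f a, f b) \<in> r"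
    using iso unfolding order_isomorphic_def iso_iff2 by blast
  have fld: "f a \<in> Field r" if "a \<in> Field s" for a using bij_betwE[OF f(1)] that by blast
  have imp: "a \<in> Field s \<and> b \<in> Field s \<and> (f a, f b) \<in> r" if "(a, b) \<in> s" for a b
    using that f(2) FieldI1[OF that] FieldI2[OF that] by blast
  show ?thesis
  proof (rule Linear_orderI)
    show "(x, x) \<in> s" if "x \<in> Field s" for x
      using that f(2) fld Linear_orderD(1)[OF r] by blast
    show "(x, z) \<in> s" if "(x, y) \<in> s" "(y, z) \<in> s" for x y z
      using imp[OF that(1)] imp[OF that(2)] f(2) Linear_orderD(2)[OF r] by blast
    show "x = y" if "(x, y) \<in> s" "(y, x) \<in> s" for x y
      using imp[OF that(1)] imp[OF that(2)] Linear_orderD(3)[OF r] f(1)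
      by (meson bij_betw_imp_inj_on inj_onD)
    show "(x, y) \<in> s \<or> (y, x) \<in> s" if "x \<in> Field s" "y \<in> Field s" for x y
      using that f(2) fld Linear_orderD(4)[OF r] by blast
  qed
qed

lemma Field_Restr_Linear_order:
  assumes "Linear_order r"
  shows "Field (Restr r S) = Field r \<inter> S"
  using Linear_orderD(1)[OF assms] unfolding Field_def by blast

lemma Linear_order_Restr':
  assumes "Linear_order r"
  shows "Linear_order (Restr r S)"
proof (rule Linear_orderI)
  note fld = Field_Restr_Linear_order[OF assms]
  show "(x, x) \<in> Restr r S" if "x \<in> Field (Restr r S)" for x
    using that Linear_orderD(1)[OF assms] unfolding fld by blast
  show "(x, z) \<in> Restr r S" if "(x, y) \<in> Restr r S" "(y, z) \<in> Restr r S" for x y z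
    using that Linear_orderD(2)[OF assms, of x y z] by blast
  show "x = y" if "(x, y) \<in> Restr r S" "(y, x) \<in> Restr r S" for x y
    using that Linear_orderD(3)[OF assms, of x y] by blast
  show "(x, y) \<in> Restr r S \<or> (y, x) \<in> Restr r S"
    if "x \<in> Field (Restr r S)" "y \<in> Field (Restr r S)" for x y
    using that Linear_orderD(4)[OF assms, of x y] unfolding fld by blast
qed

section \<open>Lexicographic products\<close>

lemma Linear_order_lex_product:
  "Linear_order r \<Longrightarrow> Linear_order s \<Longrightarrow> Linear_order (r \<times>\<^sub>l s)"
  unfolding lex_product_eq_replacement by (rule Linear_order_replacement)

lemma Field_lex_product: "Linear_order s \<Longrightarrow> Field (r \<times>\<^sub>l s) = Field r \<times> Field s"
  unfolding lex_product_eq_replacement by (rule Field_replacement)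

lemma in_lex_product_iff:
  "((a, x), (b, y)) \<in> r \<times>\<^sub>l s \<longleftrightarrow>
     a \<in> Field r \<and> b \<in> Field r \<and> x \<in> Field s \<and> y \<in> Field s \<and>
     (a \<noteq> b \<and> (a, b) \<in> r \<or> a = b \<and> (x, y) \<in> s)"
  by (auto simp: lex_product_eq_replacement replacement_def)

lemma lex_product_cong:
  assumes r: "Linear_order r" and s: "Linear_order s" and t: "Linear_order t" and "s \<cong>\<^sub>o t"
  shows "r \<times>\<^sub>l s \<cong>\<^sub>o r \<times>\<^sub>l t"
proof -
  obtain f where f: "bij_betw f (Field s) (Field t)"
    "\<forall>a\<in>Field s. \<forall>b\<in>Field s. (a, b) \<in> s \<longleftrightarrow> (f a, f b) \<in> t"
    using assms(4) unfolding order_isomorphic_def iso_iff2 by blast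
  show ?thesis
  proof (rule order_isomorphicI)
    show "bij_betw (map_prod id f) (Field (r \<times>\<^sub>l s)) (Field (r \<times>\<^sub>l t))"
      unfolding Field_lex_product[OF s] Field_lex_product[OF t]
      using f(1) by (intro bij_betw_map_prod) auto
    show "(map_prod id f p, map_prod id f q) \<in> r \<times>\<^sub>l t" if "(p, q) \<in> r \<times>\<^sub>l s" for p q
      using that f(2) bij_betwE[OF f(1)] by (cases p; cases q) (auto simp: in_lex_product_iff)
  qed (use r s t Linear_order_lex_product in auto)
qed

section \<open>Absorbing letters into \<open>A\<^sup>\<omega>\<close>\<close>

lemma omega_power_SConsI:
  assumes "u \<in> streams (Field A)" "v \<in> streams (Field A)" "a \<in> Field A" "b \<in> Field A"
    and "a \<noteq> b \<and> (a, b) \<in> A \<or> a = b \<and> (u, v) \<in> omega_power A"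
  shows "(a ## u, b ## v) \<in> omega_power A"
proof (cases "a = b")
  case False
  then have "(\<forall>i<0. (a ## u) !! i = (b ## v) !! i) \<and> (a ## u) !! 0 \<noteq> (b ## v) !! 0 \<and>
      ((a ## u) !! 0, (b ## v) !! 0) \<in> A"
    using assms(5) by simp
  then show ?thesis using assms(1-4) unfolding omega_power_def by blast
next
  case True
  show ?thesis
  proof (cases "u = v")
    case True
    then show ?thesis using \<open>a = b\<close> assms(2,4) by (simp add: omega_power_def)
  next
    case False
    then obtain n where n: "\<forall>i<n. u !! i = v !! i" "u !! n \<noteq> v !! n" "(u !! n, v !! n) \<in> A"
      using assms(5) \<open>a = b\<close> by (auto simp: omega_power_def)
    \<comment> \<open>Behind the common head, the first difference moves from \<open>n\<close> to
      \<open>Suc n\<close>.\<close>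
    have "\<forall>i<Suc n. (a ## u) !! i = (b ## v) !! i"
      using n(1) \<open>a = b\<close> by (simp add: All_less_Suc2)
    moreover have "(a ## u) !! Suc n \<noteq> (b ## v) !! Suc n" "((a ## u) !! Suc n, (b ## v) !! Suc n) \<in> A"
      using n by simp_all
    ultimately show ?thesis using assms(1-4) unfolding omega_power_def by blast
  qed
qed

text \<open>The \<open>A\<close>-coordinate becomes the head of the sequence. The index order over
  \<open>a ## u\<close> is then the one that stood over \<open>u\<close>, whence
  \<open>I \<circ> stl\<close> on the right.\<close>

lemma lex_product_replacement_omega_power:
  assumes A: "Linear_order A"
    and I: "\<And>u. u \<in> streams (Field A) \<Longrightarrow> Linear_order (I u)"
  shows "A \<times>\<^sub>l replacement (omega_power A) I \<cong>\<^sub>o replacement (omega_power A) (I \<circ> stl)"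
proof -
  let ?R = "replacement (omega_power A) I" and ?S = "replacement (omega_power A) (I \<circ> stl)"
  let ?f = "\<lambda>(a, u, i). (a ## u, i)"
  have I': "Linear_order ((I \<circ> stl) u)" if "u \<in> streams (Field A)" for u
    using I[OF streams_stl[OF that]] by simp
  have R: "Linear_order ?R" "Field ?R = (SIGMA u : streams (Field A). Field (I u))"
    using I Field_replacement[of "omega_power A" I]
      Linear_order_replacement[OF Linear_order_omega_power[OF A], of I]
    unfolding Field_omega_power by blast+
  have S: "Linear_order ?S" "Field ?S = (SIGMA u : streams (Field A). Field (I (stl u)))"
    using I' Field_replacement[of "omega_power A" "I \<circ> stl"]
      Linear_order_replacement[OF Linear_order_omega_power[OF A], of "I \<circ> stl"]
    unfolding Field_omega_power comp_def by blast+
  show ?thesis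
  proof (rule order_isomorphicI)
    show "Linear_order (A \<times>\<^sub>l ?R)" using A R(1) by (rule Linear_order_lex_product)
    show "Linear_order ?S" by (rule S)
    show "bij_betw ?f (Field (A \<times>\<^sub>l ?R)) (Field ?S)"
      unfolding Field_lex_product[OF R(1)] R(2) S(2)
      by (rule bij_betw_byWitness[where f' = "\<lambda>(u, i). (shd u, stl u, i)"])
        (auto simp: streams_shd streams_stl)
    show "(?f p, ?f q) \<in> ?S" if pq: "(p, q) \<in> A \<times>\<^sub>l ?R" for p q
    proof -
      obtain a u i b v j where eq: "p = (a, u, i)" "q = (b, v, j)"
        by (metis surj_pair)
      have *: "a \<in> Field A" "b \<in> Field A" "u \<in> streams (Field A)" "v \<in> streams (Field A)"
        "i \<in> Field (I u)" "j \<in> Field (I v)"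
        using pq unfolding eq in_lex_product_iff R(2) by auto
      \<comment> \<open>Equal new sequences are compared by their indices. Otherwise the heads
        decide, or the tails behind a common head, as \<open>omega_power_SConsI\<close>
        requires.\<close>
      consider "a ## u = b ## v" "(i, j) \<in> I u"
        | "a ## u \<noteq> b ## v" "a \<noteq> b \<and> (a, b) \<in> A \<or> a = b \<and> (u, v) \<in> omega_power A"
        using pq unfolding eq in_lex_product_iff by (auto simp: replacement_def)
      then show ?thesis
      proof cases
        case 1
        then show ?thesis using * by (auto simp: eq replacement_def Field_omega_power)
      next
        case 2
        then have "(a ## u, b ## v) \<in> omega_power A"
          using omega_power_SConsI * by metis
        then show ?thesis using 2(1) * by (auto simp: eq replacement_def Field_omega_power)
      qed
    qed
  qed
qed

lemma replacement_cong:
  "(\<And>y. y \<in> Field Y \<Longrightarrow> I y = J y) \<Longrightarrow> replacement Y I = replacement Y J"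
  by (auto simp: replacement_def)

text \<open>The two prefixes are the empty list and the two deleted letters, whose lengths have the
  same parity.\<close>

lemma tail_equiv2_stl_stl:
  assumes u: "u \<in> streams (Field A)"
  shows "tail_equiv2 A (stl (stl u)) u"
proof -
  have "u = [shd u, shd (stl u)] @- stl (stl u)" by simp
  moreover have "[shd u, shd (stl u)] \<in> lists (Field A)"
    using u by (simp add: streams_shd streams_stl)
  moreover have "stl (stl u) \<in> streams (Field A)" using u by (simp add: streams_stl)
  moreover have "length [] mod 2 = length [shd u, shd (stl u)] mod 2"
    "stl (stl u) = [] @- stl (stl u)" by simp_all
  ultimately show ?thesis unfolding tail_equiv2_def by (metis lists.Nil)
qed

text \<open>Each factor \<open>A\<close> is absorbed as one letter and shifts the family by one
  \<open>stl\<close>. After both, the family is \<open>I \<circ> stl \<circ> stl\<close>, which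
  agrees with \<open>I\<close> on \<open>streams (Field A)\<close> by invariance.\<close>

lemma lex_square_of_replacement:
  assumes A: "Linear_order A" and X: "Linear_order X"
    and I: "invariant_family2 A I" and iso: "X \<cong>\<^sub>o replacement (omega_power A) I"
  shows "A \<times>\<^sub>l A \<times>\<^sub>l X \<cong>\<^sub>o X"
proof -
  let ?W = "omega_power A"
  have lin: "Linear_order (I u)" if "u \<in> streams (Field A)" for u
    using I that unfolding invariant_family2_def by blast
  have inv: "I (stl (stl u)) = I u" if "u \<in> streams (Field A)" for u
    using I that tail_equiv2_stl_stl[OF that] streams_stl[OF streams_stl[OF that]]
    unfolding invariant_family2_def by blast
  \<comment> \<open>The second letter is absorbed into a family that is already shifted
    once.\<close>
  have lin1: "Linear_order ((I \<circ> stl) u)" if "u \<in> streams (Field A)" for u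
    using lin streams_stl[OF that] by simp
  have R: "Linear_order (replacement ?W I)" "Linear_order (replacement ?W (I \<circ> stl))"
    using lin lin1 Linear_order_replacement[OF Linear_order_omega_power[OF A]]
    unfolding Field_omega_power by blast+
  have "A \<times>\<^sub>l A \<times>\<^sub>l X \<cong>\<^sub>o A \<times>\<^sub>l A \<times>\<^sub>l replacement ?W I"
    by (intro lex_product_cong Linear_order_lex_product A X R iso)
  also have "\<dots> \<cong>\<^sub>o A \<times>\<^sub>l replacement ?W (I \<circ> stl)"
    by (intro lex_product_cong Linear_order_lex_product A R lex_product_replacement_omega_power lin)
  also have "\<dots> \<cong>\<^sub>o replacement ?W (I \<circ> stl \<circ> stl)"
    by (intro A lex_product_replacement_omega_power lin1)
  also have "replacement ?W (I \<circ> stl \<circ> stl) = replacement ?W I"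
    using inv by (intro replacement_cong) (simp add: Field_omega_power)
  also have "\<dots> \<cong>\<^sub>o X" using iso by (rule order_isomorphic_sym)
  finally show ?thesis .
qed

section \<open>Coding points by sequences of letters\<close>

text \<open>The flag says whether the next letter is the second of its pair.\<close>

primcorec code_stream :: "('x \<Rightarrow> 'a \<times> 'a \<times> 'x) \<Rightarrow> bool \<Rightarrow> 'x \<Rightarrow> 'a stream" where
  "shd (code_stream g b x) = (if b then fst (snd (g x)) else fst (g x))"
| "stl (code_stream g b x) = code_stream g (\<not> b) (if b then snd (snd (g x)) else x)"

locale lex_square_iso =
  fixes A :: "'a rel" and X :: "'x rel" and g :: "'x \<Rightarrow> 'a \<times> 'a \<times> 'x"
  assumes A: "Linear_order A" and X: "Linear_order X" and g: "iso X (A \<times>\<^sub>l A \<times>\<^sub>l X) g"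
begin

definition code :: "'x \<Rightarrow> 'a stream" where
  "code = code_stream g False"

text \<open>A relation on the type of \<open>X\<close>, so that families of fibres have type
  \<open>'a stream \<Rightarrow> 'x rel\<close>. It is empty over a sequence that codes no point of
  \<open>X\<close>.\<close>

definition fibre :: "'a stream \<Rightarrow> 'x rel" where
  "fibre u = Restr X {x. code x = u}"

text \<open>Two corecursive steps make one turn of \<open>g\<close>: the first keeps the point and
  sets the flag, the second moves on to the \<open>X\<close>-coordinate and clears it.\<close>

lemma code_eq:
  assumes "g x = (a, b, x')"
  shows "code x = a ## b ## code x'"
proof -
  have "code_stream g False x = a ## code_stream g True x"
    using assms code_stream.code[of g False x] by simp
  also have "code_stream g True x = b ## code_stream g False x'"
    using assms code_stream.code[of g True x] by simp
  finally show ?thesis unfolding code_def .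
qed

lemma bij_g: "bij_betw g (Field X) (Field A \<times> Field A \<times> Field X)"
  using g unfolding iso_iff2 Field_lex_product[OF X]
    Field_lex_product[OF Linear_order_lex_product[OF A X]] by blast

lemma g_in_Field:
  assumes "x \<in> Field X"
  obtains a b x' where "g x = (a, b, x')" "a \<in> Field A" "b \<in> Field A" "x' \<in> Field X"
  using bij_betwE[OF bij_g] assms by (metis SigmaE)

lemma g_order:
  "x \<in> Field X \<Longrightarrow> y \<in> Field X \<Longrightarrow> (x, y) \<in> X \<longleftrightarrow> (g x, g y) \<in> A \<times>\<^sub>l A \<times>\<^sub>l X"
  using g unfolding iso_iff2 by blast

lemma code_in_streams: "x \<in> Field X \<Longrightarrow> code x \<in> streams (Field A)"
proof -
  assume "x \<in> Field X"
  then have "code x !! n \<in> Field A" for n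
  \<comment> \<open>Two base cases, because \<open>code_eq\<close> peels off two letters at a time;
    the hypothesis for \<open>n\<close> is applied to the \<open>X\<close>-coordinate of
    \<open>g x\<close>.\<close>
  proof (induction n arbitrary: x rule: induct_nat_012)
    case 0 then show ?case by (rule g_in_Field) (simp add: code_eq)
  next
    case 1 then show ?case by (rule g_in_Field) (simp add: code_eq)
  next
    case (ge2 n) from ge2.prems show ?case by (rule g_in_Field) (simp add: code_eq ge2.IH(1))
  qed
  then show ?thesis by (simp add: streams_iff_snth)
qed

text \<open>A comparison in \<open>A\<^sup>2X\<close> is decided by the first letter, by the second,
  or by the \<open>X\<close>-coordinates, whose codes are the old ones shifted by two. The
  non-strict form also covers codes that never differ.\<close>

lemma code_mono_snth:
  assumes "(x, y) \<in> X" "\<forall>i<n. code x !! i = code y !! i"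
  shows "(code x !! n, code y !! n) \<in> A"
  using assms
proof (induction n arbitrary: x y rule: less_induct)
  case (less n)
  have xy: "x \<in> Field X" "y \<in> Field X" using less.prems(1) by (auto intro: FieldI1 FieldI2)
  obtain a b x' where x: "g x = (a, b, x')" "a \<in> Field A" "b \<in> Field A"
    using xy(1) by (rule g_in_Field)
  obtain c d y' where y: "g y = (c, d, y')"
    using xy(2) by (rule g_in_Field)
  have le: "a \<noteq> c \<and> (a, c) \<in> A \<or> a = c \<and> (b \<noteq> d \<and> (b, d) \<in> A \<or> b = d \<and> (x', y') \<in> X)"
    using less.prems(1) g_order[OF xy] x(1) y by (simp add: in_lex_product_iff) blast
  note refl = Linear_orderD(1)[OF A]
  have code: "code x = a ## b ## code x'" "code y = c ## d ## code y'"
    using x(1) y by (simp_all add: code_eq)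
  consider "n = 0" | "n = 1" | m where "n = Suc (Suc m)"
    by (metis One_nat_def old.nat.exhaust)
  then show ?case
  proof cases
    case 1
    then show ?thesis using le refl[OF x(2)] by (auto simp: code)
  next
    case 2
    then have "a = c" using less.prems(2) by (simp add: code)
    then show ?thesis using 2 le refl[OF x(3)] by (auto simp: code)
  next
    case 3
    have agree: "(a ## b ## code x') !! i = (c ## d ## code y') !! i" if "i < n" for i
      using less.prems(2) that unfolding code by blast
    \<comment> \<open>Agreement at positions 0 and 1 leaves only the last alternative of
      \<open>le\<close>, namely that \<open>x'\<close> is below \<open>y'\<close>.\<close>
    have "a = c" "b = d" using agree[of 0] agree[of 1] 3 by simp_all
    moreover have "\<forall>i<m. code x' !! i = code y' !! i"
      using agree[of "Suc (Suc _)"] 3 by simp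
    ultimately show ?thesis using less.IH[of m x' y'] le 3 by (simp add: code)
  qed
qed

lemma code_mono:
  assumes xy: "(x, y) \<in> X"
  shows "(code x, code y) \<in> omega_power A"
proof (rule ccontr)
  assume neg: "(code x, code y) \<notin> omega_power A"
  have st: "code x \<in> streams (Field A)" "code y \<in> streams (Field A)"
    using xy by (auto intro: code_in_streams FieldI1 FieldI2)
  have "code x \<noteq> code y" using neg st by (auto simp: omega_power_def)
  \<comment> \<open>A stream is the image of \<open>nats\<close> under its own \<open>snth\<close>,
    so streams with equal entries are equal.\<close>
  then have ex: "\<exists>n. code x !! n \<noteq> code y !! n"
    by (metis ext stream_smap_nats)
  define n where "n = (LEAST n. code x !! n \<noteq> code y !! n)"
  have "code x !! n \<noteq> code y !! n" and n: "\<forall>i<n. code x !! i = code y !! i"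
    unfolding n_def using LeastI_ex[OF ex] not_less_Least by blast+
  then show False using neg st code_mono_snth[OF xy n] unfolding omega_power_def by blast
qed

section \<open>Fibres of the coding and their shifts\<close>

lemma Field_fibre: "Field (fibre u) = {x \<in> Field X. code x = u}"
  unfolding fibre_def Field_Restr_Linear_order[OF X] by blast

lemma Linear_order_fibre: "Linear_order (fibre u)"
  unfolding fibre_def using X by (rule Linear_order_Restr')

text \<open>The map \<open>g\<close> sends this fibre onto the triples \<open>(a, b, y)\<close> with
  \<open>y\<close> in the fibre over \<open>u\<close>. With both letters fixed, the lexicographic
  order on them is that of the last coordinate.\<close>

lemma fibre_SCons_SCons:
  assumes ab: "a \<in> Field A" "b \<in> Field A"
  shows "fibre (a ## b ## u) \<cong>\<^sub>o fibre u"
proof -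
  let ?t = "\<lambda>x. snd (snd (g x))"
  have t: "g x = (a, b, ?t x) \<and> ?t x \<in> Field X \<and> code (?t x) = u"
    if "x \<in> Field X" "code x = a ## b ## u" for x
    using that(1) by (rule g_in_Field) (use that(2) in \<open>auto simp: code_eq\<close>)
  show ?thesis
  proof (rule order_isomorphicI)
    have "inj_on ?t (Field (fibre (a ## b ## u)))"
    proof (rule inj_onI)
      fix x y assume *: "x \<in> Field (fibre (a ## b ## u))" "y \<in> Field (fibre (a ## b ## u))" "?t x = ?t y"
      then have "g x = g y" using t[of x] t[of y] by (simp add: Field_fibre)
      then show "x = y" using * bij_betw_imp_inj_on[OF bij_g] by (simp add: Field_fibre inj_onD)
    qed
    moreover have "?t ` Field (fibre (a ## b ## u)) = Field (fibre u)"
    proof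
      show "?t ` Field (fibre (a ## b ## u)) \<subseteq> Field (fibre u)" using t by (auto simp: Field_fibre)
      show "Field (fibre u) \<subseteq> ?t ` Field (fibre (a ## b ## u))"
      proof
        fix y assume y: "y \<in> Field (fibre u)"
        \<comment> \<open>The preimage exists because \<open>g\<close> is onto and \<open>a\<close>,
          \<open>b\<close> lie in \<open>Field A\<close>.\<close>
        then have "(a, b, y) \<in> g ` Field X"
          using ab bij_g by (simp add: Field_fibre bij_betw_def)
        then obtain x where x: "x \<in> Field X" "g x = (a, b, y)" by (metis imageE)
        then have "x \<in> Field (fibre (a ## b ## u))" using y by (simp add: Field_fibre code_eq)
        then show "y \<in> ?t ` Field (fibre (a ## b ## u))" using x(2) by (auto intro: rev_image_eqI)
      qed
    qed
    ultimately show "bij_betw ?t (Field (fibre (a ## b ## u))) (Field (fibre u))"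
      by (simp add: bij_betw_def)
    show "(?t x, ?t y) \<in> fibre u" if "(x, y) \<in> fibre (a ## b ## u)" for x y
    proof -
      have xy: "(x, y) \<in> X" "x \<in> Field X" "y \<in> Field X" "code x = a ## b ## u" "code y = a ## b ## u"
        using that by (auto simp: fibre_def intro: FieldI1 FieldI2)
      have "((a, b, ?t x), (a, b, ?t y)) \<in> A \<times>\<^sub>l A \<times>\<^sub>l X"
        using xy(1) g_order[OF xy(2,3)] t[OF xy(2,4)] t[OF xy(3,5)] by metis
      then have "(?t x, ?t y) \<in> X" by (simp add: in_lex_product_iff)
      then show ?thesis using t[OF xy(2,4)] t[OF xy(3,5)] by (simp add: fibre_def)
    qed
  qed (rule Linear_order_fibre)+
qed

text \<open>The prefix is removed two letters at a time; parity rules out the one-letter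
  remainder.\<close>

lemma fibre_shift:
  assumes "r \<in> lists (Field A)" "even (length r)"
  shows "fibre (r @- u) \<cong>\<^sub>o fibre u"
  using assms
proof (induction r rule: induct_list012)
  case 1 show ?case by (simp add: order_isomorphic_refl)
next
  case (2 x) then show ?case by simp
next
  case (3 x y zs)
  then show ?case
    using order_isomorphic_trans[OF fibre_SCons_SCons[of x y "zs @- u"]] by simp
qed

text \<open>For prefixes of even length, both fibres are isomorphic to the fibre over the common
  tail; the odd case is reduced to this one.\<close>

lemma fibre_tail_equiv2:
  assumes "tail_equiv2 A u v"
  shows "fibre u \<cong>\<^sub>o fibre v"
proof -
  obtain r s w where rs: "r \<in> lists (Field A)" "s \<in> lists (Field A)" and w: "w \<in> streams (Field A)"
    and len: "length r mod 2 = length s mod 2" and uv: "u = r @- w" "v = s @- w"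
    using assms unfolding tail_equiv2_def by blast
  have *: "fibre u \<cong>\<^sub>o fibre v" if "r \<in> lists (Field A)" "s \<in> lists (Field A)"
    "even (length r)" "even (length s)" "u = r @- w" "v = s @- w" for r s w
    using that fibre_shift order_isomorphic_sym order_isomorphic_trans by metis
  show ?thesis
  proof (cases "even (length r)")
    case True
    then have "even (length s)" using len by (simp add: even_iff_mod_2_eq_zero)
    then show ?thesis using * rs True uv by blast
  next
    \<comment> \<open>Moving one letter of the common tail into both prefixes makes their lengths even.\<close>
    case False
    then have "odd (length s)" using len by (simp add: even_iff_mod_2_eq_zero)
    then show ?thesis
      using False rs w uv by (intro *[of "r @ [shd w]" "s @ [shd w]" "stl w"]) (auto simp: streams_shd)
  qed
qed

section \<open>From isomorphic fibres to equal index orders\<close>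

text \<open>Isomorphic fibres yield the same predicate, so the choice depends on the isomorphism type only.\<close>

definition fibre_rep :: "'a stream \<Rightarrow> 'x rel" where
  "fibre_rep u = (SOME r. r \<cong>\<^sub>o fibre u)"

lemma fibre_rep_iso: "fibre_rep u \<cong>\<^sub>o fibre u"
  unfolding fibre_rep_def by (rule someI) (rule order_isomorphic_refl)

lemma fibre_rep_cong:
  assumes "fibre u \<cong>\<^sub>o fibre v"
  shows "fibre_rep u = fibre_rep v"
proof -
  have "r \<cong>\<^sub>o fibre u \<longleftrightarrow> r \<cong>\<^sub>o fibre v" for r :: "'x rel"
    using assms order_isomorphic_sym order_isomorphic_trans by blast
  then show ?thesis unfolding fibre_rep_def by presburger
qed

lemma Linear_order_fibre_rep: "Linear_order (fibre_rep u)"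
  using Linear_order_fibre fibre_rep_iso by (rule Linear_order_isomorphic)

lemma invariant_fibre_rep: "invariant_family2 A fibre_rep"
  unfolding invariant_family2_def
  using Linear_order_fibre_rep fibre_tail_equiv2 fibre_rep_cong by blast

text \<open>A point goes to its code, paired with its image under a chosen isomorphism from its
  fibre to the representative. Points with different codes are compared by \<open>code_mono\<close>,
  points with the same code by that isomorphism.\<close>

lemma iso_replacement_fibre_rep: "X \<cong>\<^sub>o replacement (omega_power A) fibre_rep"
proof -
  let ?R = "replacement (omega_power A) fibre_rep"
  have "\<exists>f. iso (fibre u) (fibre_rep u) f" for u
    using order_isomorphic_sym[OF fibre_rep_iso] unfolding order_isomorphic_def .
  then obtain h where "\<And>u. iso (fibre u) (fibre_rep u) (h u)" by metis
  then have h: "bij_betw (h u) (Field (fibre u)) (Field (fibre_rep u))"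
    "\<lbrakk>x \<in> Field (fibre u); y \<in> Field (fibre u)\<rbrakk> \<Longrightarrow> (x, y) \<in> fibre u \<longleftrightarrow> (h u x, h u y) \<in> fibre_rep u"
    for u x y unfolding iso_iff2 by blast+
  let ?f = "\<lambda>x. (code x, h (code x) x)"
  have hf: "h (code x) x \<in> Field (fibre_rep (code x))" if "x \<in> Field X" for x
    using bij_betwE[OF h(1)] that by (simp add: Field_fibre)
  have FR: "Field ?R = (SIGMA u : streams (Field A). Field (fibre_rep u))"
    by (simp add: Field_replacement Linear_order_fibre_rep Field_omega_power)
  show ?thesis
  proof (rule order_isomorphicI)
    show "Linear_order X" by (rule X)
    show "Linear_order ?R"
      by (intro Linear_order_replacement Linear_order_omega_power A Linear_order_fibre_rep)
    have "inj_on ?f (Field X)"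
    proof (rule inj_onI)
      fix x y assume "x \<in> Field X" "y \<in> Field X" "?f x = ?f y"
      then show "x = y" using inj_onD[OF bij_betw_imp_inj_on[OF h(1)], of "code x" x y]
        by (auto simp: Field_fibre)
    qed
    moreover have "?f ` Field X = Field ?R"
    proof
      show "?f ` Field X \<subseteq> Field ?R" unfolding FR using hf code_in_streams by auto
      show "Field ?R \<subseteq> ?f ` Field X"
      proof
        fix p assume "p \<in> Field ?R"
        then obtain u i where p: "p = (u, i)" "i \<in> Field (fibre_rep u)" unfolding FR by auto
        then obtain x where "x \<in> Field (fibre u)" "i = h u x"
          using h(1)[of u] unfolding bij_betw_def by blast
        then show "p \<in> ?f ` Field X" using p(1) by (auto simp: Field_fibre)
      qed
    qed
    ultimately show "bij_betw ?f (Field X) (Field ?R)" by (simp add: bij_betw_def)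
    show "(?f x, ?f y) \<in> ?R" if xy: "(x, y) \<in> X" for x y
    proof -
      have F: "x \<in> Field X" "y \<in> Field X" using xy by (auto intro: FieldI1 FieldI2)
      have "(h (code x) x, h (code x) y) \<in> fibre_rep (code x)" if "code x = code y"
        using that xy F h(2)[of x "code x" y] by (simp add: Field_fibre) (simp add: fibre_def)
      then show ?thesis using code_mono[OF xy] hf code_in_streams F
        by (auto simp: replacement_def Field_omega_power)
    qed
  qed
qed

end

text \<open>The family built from an isomorphism consists of copies of suborders of
  \<open>X\<close>, so index orders on \<open>'x\<close> suffice for existence. The last conjunct
  gives the converse for any index type \<open>'i\<close>, so fixing \<open>'x\<close> in the
  equivalence loses no generality.\<close>

theorem theorem3p10:
  fixes A :: "'a rel" and X :: "'x rel"
  assumes "Linear_order A" and "Linear_order X"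
  shows "(A \<times>\<^sub>l A \<times>\<^sub>l X \<cong>\<^sub>o X \<longleftrightarrow>
            (\<exists>I :: 'a stream \<Rightarrow> 'x rel. invariant_family2 A I \<and> X \<cong>\<^sub>o replacement (omega_power A) I)) \<and>
         (\<forall>I :: 'a stream \<Rightarrow> 'i rel.
            invariant_family2 A I \<and> X \<cong>\<^sub>o replacement (omega_power A) I \<longrightarrow> A \<times>\<^sub>l A \<times>\<^sub>l X \<cong>\<^sub>o X)"
proof (intro conjI iffI allI impI)
  assume "A \<times>\<^sub>l A \<times>\<^sub>l X \<cong>\<^sub>o X"
  \<comment> \<open>The isomorphism is reversed so that \<open>g\<close> starts from
    \<open>X\<close> and can be iterated on the last coordinate of its values.\<close>
  then obtain g where "iso X (A \<times>\<^sub>l A \<times>\<^sub>l X) g"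
    using order_isomorphic_sym unfolding order_isomorphic_def by blast
  then interpret lex_square_iso A X g using assms by unfold_locales
  show "\<exists>I :: 'a stream \<Rightarrow> 'x rel. invariant_family2 A I \<and> X \<cong>\<^sub>o replacement (omega_power A) I"
    using invariant_fibre_rep iso_replacement_fibre_rep by blast
qed (use lex_square_of_replacement[OF assms] in blast)+

end
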